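(* Let $G$ be a connected graph with $\sigma_2\ge t_{k+1}-k+1$ and $k$ a positive integer. Then $G$ has a spanning $k$-ended tree.
   Context: All graphs are finite, undirected, without loops or multiple edges. For a graph $G$ with independence number $\alpha$: if $\alpha\ge 2$, $\sigma_2$ is the minimum degree sum $d(x)+d(y)$ over pairs of nonadjacent vertices $x,y$; otherwise $\sigma_2=+\infty$. A vertex of degree one of a tree is a leaf; a tree $T$ is $k$-ended if it has at most $k$ leaves. Each vertex and each edge is interpreted as a simple cycle of order 1 and 2, respectively; a Hamilton cycle is interpreted as a spanning 1-ended tree, and a Hamilton path is a spanning 2-ended tree. $t_k$ denotes the order (number of vertices) of a largest $k$-ended tree in $G$; in particular $t_1$ is the order of a longest cycle and $t_2$ is the order of a longest path in $G$. *)

theory Defs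
  imports "HOL-Library.Extended_Real"
begin

record 'a ugraph =
  verts :: "'a set"
  edges :: "'a set set"

definition simple_graph :: "'a ugraph \<Rightarrow> bool" where
  "simple_graph G \<longleftrightarrow> finite (verts G) \<and>
     (\<forall>e\<in>edges G. \<exists>u\<in>verts G. \<exists>v\<in>verts G. u \<noteq> v \<and> e = {u, v})"

definition adjacent :: "'a ugraph \<Rightarrow> 'a \<Rightarrow> 'a \<Rightarrow> bool" where
  "adjacent G u v \<longleftrightarrow> {u, v} \<in> edges G"

definition degree :: "'a ugraph \<Rightarrow> 'a \<Rightarrow> nat" where
  "degree G v = card {e \<in> edges G. v \<in> e}"

text \<open>A connected graph has at least one vertex.\<close>

definition connected_graph :: "'a ugraph \<Rightarrow> bool" where
  "connected_graph G \<longleftrightarrow> verts G \<noteq> {} \<and>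
     (\<forall>u\<in>verts G. \<forall>v\<in>verts G. (adjacent G)\<^sup>*\<^sup>* u v)"

definition subgraph_of :: "'a ugraph \<Rightarrow> 'a ugraph \<Rightarrow> bool" where
  "subgraph_of H G \<longleftrightarrow> simple_graph H \<and> verts H \<subseteq> verts G \<and> edges H \<subseteq> edges G"

definition spanning_subgraph :: "'a ugraph \<Rightarrow> 'a ugraph \<Rightarrow> bool" where
  "spanning_subgraph H G \<longleftrightarrow> subgraph_of H G \<and> verts H = verts G"

text \<open>
  Simple cycles, including the degenerate ones: a single vertex is a cycle of order 1, and
  for a list of length 2 the two cyclically consecutive pairs coincide as sets, so that a
  single edge is a cycle of order 2.
\<close>

definition cycle_edges :: "'a list \<Rightarrow> 'a set set" where
  "cycle_edges vs = (if length vs = 1 then {}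
     else {{vs ! i, vs ! (Suc i mod length vs)} | i. i < length vs})"

definition simple_cycle :: "'a ugraph \<Rightarrow> bool" where
  "simple_cycle C \<longleftrightarrow>
     (\<exists>vs. vs \<noteq> [] \<and> distinct vs \<and> verts C = set vs \<and> edges C = cycle_edges vs)"

text \<open>Only cycles of order at least 3 count for acyclicity.\<close>

definition is_tree :: "'a ugraph \<Rightarrow> bool" where
  "is_tree T \<longleftrightarrow> simple_graph T \<and> connected_graph T \<and>
     \<not> (\<exists>C. subgraph_of C T \<and> simple_cycle C \<and> card (verts C) \<ge> 3)"

definition leaves :: "'a ugraph \<Rightarrow> 'a set" where
  "leaves T = {v \<in> verts T. degree T v = 1}"

text \<open>
  By convention the 1-ended trees are the simple cycles (including those of order 1 and 2);
  thus a spanning 1-ended tree is a Hamilton cycle. For \<open>k \<ge> 2\<close> a \<open>k\<close>-ended tree is a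
  genuine tree with at most \<open>k\<close> leaves.
\<close>

definition ended_tree :: "nat \<Rightarrow> 'a ugraph \<Rightarrow> bool" where
  "ended_tree k T \<longleftrightarrow>
     (if k = 1 then simple_cycle T else is_tree T \<and> card (leaves T) \<le> k)"

definition max_ended_order :: "'a ugraph \<Rightarrow> nat \<Rightarrow> nat" where
  "max_ended_order G k = Max {card (verts T) | T. subgraph_of T G \<and> ended_tree k T}"

definition independent_set :: "'a ugraph \<Rightarrow> 'a set \<Rightarrow> bool" where
  "independent_set G S \<longleftrightarrow> S \<subseteq> verts G \<and> (\<forall>u\<in>S. \<forall>v\<in>S. \<not> adjacent G u v)"

definition independence_number :: "'a ugraph \<Rightarrow> nat" where
  "independence_number G = Max {card S | S. independent_set G S}"

definition sigma2 :: "'a ugraph \<Rightarrow> ereal" where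
  "sigma2 G = (if independence_number G \<ge> 2
     then ereal (real (Min {degree G x + degree G y | x y.
            x \<in> verts G \<and> y \<in> verts G \<and> x \<noteq> y \<and> \<not> adjacent G x y}))
     else \<infinity>)"

end

theory Submission
  imports Defs
begin

text \<open>
  Let \<open>T\<close> be a largest \<open>(k+1)\<close>-ended tree and suppose that no spanning \<open>k\<close>-ended tree exists.
  Then \<open>T\<close> has exactly \<open>k + 1\<close> leaves, since otherwise a pendant edge could be added. No two
  leaves are adjacent in \<open>G\<close>: the edge joining them closes a cycle, and deleting a cycle
  edge at a branch vertex saves a leaf (if there is no branch vertex, \<open>T\<close> is a path and the
  cycle is Hamiltonian). Let \<open>x\<close> and \<open>y\<close> be leaves and root \<open>T\<close> at \<open>x\<close>. All neighbours
  of \<open>x\<close> and \<open>y\<close> lie in \<open>T\<close>. For a neighbour \<open>z\<close> of \<open>x\<close> with parent \<open>z' \<noteq> x\<close>, exchanging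
  the edge \<open>z z'\<close> for \<open>x z\<close> gives another largest tree, in which \<open>y\<close> and \<open>z'\<close> are leaves. So
  \<open>z'\<close> has degree 2 in \<open>T\<close> and is not adjacent to \<open>y\<close>; in particular taking parents is injective
  on the neighbours of \<open>x\<close>. Hence \<open>d(x) + d(y) \<le> |T| - k\<close>, contradicting the degree condition.
\<close>

section \<open>Adjacency, neighbourhoods and connectedness\<close>

lemma adjacent_sym: "adjacent G u v \<Longrightarrow> adjacent G v u"
  by (simp add: adjacent_def insert_commute)

lemma adjacent_in_verts:
  assumes "simple_graph G" "adjacent G u v"
  shows "u \<in> verts G" "v \<in> verts G" "u \<noteq> v"
proof -
  obtain a b where "a \<in> verts G" "b \<in> verts G" "a \<noteq> b" "{u, v} = {a, b}"
    using assms unfolding simple_graph_def adjacent_def by blast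
  then show "u \<in> verts G" "v \<in> verts G" "u \<noteq> v" by (auto simp: doubleton_eq_iff)
qed

lemma simple_graph_finite_edges:
  assumes "simple_graph G"
  shows "finite (edges G)"
proof -
  have "edges G \<subseteq> Pow (verts G)"
    using assms unfolding simple_graph_def by fastforce
  then show ?thesis
    using assms by (meson finite_Pow_iff finite_subset simple_graph_def)
qed

definition nbrs :: "'a ugraph \<Rightarrow> 'a \<Rightarrow> 'a set" where
  "nbrs G v = {u. adjacent G v u}"

lemma nbrs_subset_verts: "simple_graph G \<Longrightarrow> nbrs G v \<subseteq> verts G"
  using adjacent_in_verts(2) by (fastforce simp: nbrs_def)

lemma finite_nbrs: "simple_graph G \<Longrightarrow> finite (nbrs G v)"
  by (meson finite_subset nbrs_subset_verts simple_graph_def)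

lemma degree_eq_card_nbrs:
  assumes "simple_graph G"
  shows "degree G v = card (nbrs G v)"
proof -
  have "bij_betw (\<lambda>u. {v, u}) (nbrs G v) {e \<in> edges G. v \<in> e}"
    unfolding bij_betw_def
  proof
    show "inj_on (\<lambda>u. {v, u}) (nbrs G v)"
      by (auto simp: inj_on_def doubleton_eq_iff)
    show "(\<lambda>u. {v, u}) ` nbrs G v = {e \<in> edges G. v \<in> e}"
    proof (intro equalityI subsetI)
      fix e assume e: "e \<in> {e \<in> edges G. v \<in> e}"
      then obtain a b where "e = {a, b}"
        using assms unfolding simple_graph_def by blast
      with e obtain u where "e = {v, u}" by auto
      with e show "e \<in> (\<lambda>u. {v, u}) ` nbrs G v"
        by (auto simp: nbrs_def adjacent_def)
    qed (auto simp: nbrs_def adjacent_def)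
  qed
  then show ?thesis
    by (simp add: degree_def bij_betw_same_card)
qed

lemma card_le_degree:
  assumes "simple_graph G" "A \<subseteq> nbrs G v"
  shows "card A \<le> degree G v"
  by (simp add: assms card_mono degree_eq_card_nbrs finite_nbrs)

lemma nbrs_eqI:
  assumes "simple_graph G" "A \<subseteq> nbrs G v" "degree G v \<le> card A"
  shows "nbrs G v = A"
  by (metis assms card_seteq degree_eq_card_nbrs finite_nbrs)

text \<open>Follows by induction along a walk that starts in \<open>C\<close>. It is the tool for
  showing that a tree spans \<open>G\<close>, or that a path exhausts a tree: no edge leaves
  it.\<close>

lemma adjacent_closed_eq_verts:
  assumes "connected_graph G" "C \<subseteq> verts G" "C \<noteq> {}"
    and "\<And>u v. u \<in> C \<Longrightarrow> adjacent G u v \<Longrightarrow> v \<in> C"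
  shows "C = verts G"
proof (intro equalityI assms(2) subsetI)
  fix v assume v: "v \<in> verts G"
  obtain u where u: "u \<in> C" using assms(3) by blast
  have "(adjacent G)\<^sup>*\<^sup>* u v"
    using assms(1,2) u v by (auto simp: connected_graph_def)
  then show "v \<in> C"
    by (induction) (auto simp: u assms(4))
qed

lemma connected_graphI:
  assumes "r \<in> verts G" "\<And>v. v \<in> verts G \<Longrightarrow> (adjacent G)\<^sup>*\<^sup>* v r"
  shows "connected_graph G"
  unfolding connected_graph_def
proof (intro conjI ballI)
  fix u v assume u: "u \<in> verts G" and v: "v \<in> verts G"
  have "symp (adjacent G)" by (simp add: adjacent_sym sympI)
  then have "(adjacent G)\<^sup>*\<^sup>* r v"
    using assms(2)[OF v] by (metis symp_rtranclp sympD)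
  with assms(2)[OF u] show "(adjacent G)\<^sup>*\<^sup>* u v" by (rule rtranclp_trans)
qed (use assms in auto)

section \<open>Breadth-first levels and parents\<close>

text \<open>Distances from \<open>r\<close> together with parents one level closer to
  \<open>r\<close>. For a tree this is the rooting at \<open>r\<close>; for a general connected
  graph the parent edges form a breadth-first spanning tree. The value of \<open>par r\<close> is
  left open.\<close>

definition bfs :: "'a ugraph \<Rightarrow> 'a \<Rightarrow> ('a \<Rightarrow> nat) \<Rightarrow> ('a \<Rightarrow> 'a) \<Rightarrow> bool" where
  "bfs G r d par \<longleftrightarrow> r \<in> verts G \<and> d r = 0 \<and>
     (\<forall>v\<in>verts G - {r}. par v \<in> verts G \<and> adjacent G (par v) v \<and> d v = Suc (d (par v))) \<and>
     (\<forall>u v. u \<in> verts G \<longrightarrow> adjacent G u v \<longrightarrow> d v \<le> Suc (d u))"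

text \<open>Take \<open>d v\<close> to be the length of a shortest walk from \<open>r\<close> to
  \<open>v\<close>. The last but one vertex of such a walk serves as the parent.\<close>

lemma bfs_exists:
  assumes "simple_graph G" "connected_graph G" "r \<in> verts G"
  obtains d par where "bfs G r d par"
proof -
  define d where "d v = (LEAST n. (adjacent G ^^ n) r v)" for v
  have ex: "\<exists>n. (adjacent G ^^ n) r v" if "v \<in> verts G" for v
    using assms that unfolding connected_graph_def by (meson rtranclp_imp_relpowp)
  have reach: "(adjacent G ^^ d v) r v" if "v \<in> verts G" for v
    unfolding d_def using ex[OF that] by (rule LeastI_ex)
  have le: "d v \<le> n" if "(adjacent G ^^ n) r v" for n v
    unfolding d_def using that by (rule Least_le)
  have step: "d v \<le> Suc (d u)" if "u \<in> verts G" "adjacent G u v" for u v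
    using le reach that by (meson relpowp_Suc_I)
  have "\<exists>u. u \<in> verts G \<and> adjacent G u v \<and> d v = Suc (d u)" if v: "v \<in> verts G - {r}" for v
  proof -
    have "d v \<noteq> 0" using reach[of v] v by (auto intro: ccontr)
    then obtain m where m: "d v = Suc m" by (meson not0_implies_Suc)
    then obtain u where u: "(adjacent G ^^ m) r u" "adjacent G u v"
      using reach[of v] v by (metis DiffD1 relpowp_Suc_E)
    then have uV: "u \<in> verts G" using adjacent_in_verts assms(1) by metis
    have "d u = m" using le[OF u(1)] step[OF uV u(2)] m by simp
    with uV u m show ?thesis by blast
  qed
  then obtain par where
    "\<forall>v\<in>verts G - {r}. par v \<in> verts G \<and> adjacent G (par v) v \<and> d v = Suc (d (par v))"
    by metis
  moreover have "d r = 0" using le[of 0 r] by simp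
  ultimately have "bfs G r d par"
    unfolding bfs_def using assms(3) step by blast
  then show ?thesis by (rule that)
qed

text \<open>Climbing from parent to parent never visits a level above \<open>d v\<close>, so only
  these parent edges have to be present in \<open>H\<close>. This allows \<open>H\<close> to be
  \<open>G\<close> with an edge removed.\<close>

lemma bfs_reach_root:
  assumes "bfs G r d par" "v \<in> verts G"
    and "\<And>w. w \<in> verts G - {r} \<Longrightarrow> d w \<le> d v \<Longrightarrow> adjacent H w (par w)"
  shows "(adjacent H)\<^sup>*\<^sup>* v r"
  using assms(2,3)
proof (induction "d v" arbitrary: v rule: less_induct)
  case less
  show ?case
  proof (cases "v = r")
    case False
    with less.prems assms(1) have p: "par v \<in> verts G" "d v = Suc (d (par v))"
      by (auto simp: bfs_def)
    have "(adjacent H)\<^sup>*\<^sup>* (par v) r"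
      using less.hyps[of "par v"] p less.prems(2) by auto
    moreover have "adjacent H v (par v)"
      using less.prems False by auto
    ultimately show ?thesis by (rule converse_rtranclp_into_rtranclp[rotated])
  qed simp
qed

text \<open>A parent edge determines its child, which is the endpoint at the larger level.\<close>

lemma bfs_inj_parent_edge:
  assumes "bfs G r d par"
  shows "inj_on (\<lambda>w. {w, par w}) (verts G - {r})"
proof (rule inj_onI, rule ccontr)
  fix w w' assume *: "w \<in> verts G - {r}" "w' \<in> verts G - {r}" "{w, par w} = {w', par w'}" "w \<noteq> w'"
  then have "w = par w'" "w' = par w" by (auto simp: doubleton_eq_iff)
  moreover have "d w = Suc (d (par w))" "d w' = Suc (d (par w'))"
    using assms *(1,2) unfolding bfs_def by blast+
  ultimately show False by simp
qed

lemma bfs_parent_edges_subset: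
  assumes "bfs G r d par"
  shows "(\<lambda>w. {w, par w}) ` (verts G - {r}) \<subseteq> edges G"
proof
  fix e assume "e \<in> (\<lambda>w. {w, par w}) ` (verts G - {r})"
  then obtain w where "w \<in> verts G - {r}" "e = {w, par w}" by blast
  moreover from this have "adjacent G (par w) w" using assms unfolding bfs_def by blast
  ultimately show "e \<in> edges G" by (simp add: adjacent_def insert_commute)
qed

text \<open>The vertices other than the root have pairwise distinct parent edges.\<close>

lemma connected_card_le:
  assumes "simple_graph G" "connected_graph G"
  shows "card (verts G) \<le> Suc (card (edges G))"
proof -
  obtain r where r: "r \<in> verts G" using assms(2) by (auto simp: connected_graph_def)
  obtain d par where b: "bfs G r d par" using bfs_exists[OF assms r] by blast
  have "card (verts G - {r}) \<le> card (edges G)"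
    using bfs_inj_parent_edge[OF b] bfs_parent_edges_subset[OF b]
      simple_graph_finite_edges[OF assms(1)] by (rule card_inj_on_le)
  moreover have "Suc (card (verts G - {r})) = card (verts G)"
    using assms(1) r by (intro card_Suc_Diff1) (auto simp: simple_graph_def)
  ultimately show ?thesis by simp
qed

section \<open>Cycles, bridges and the edge count of a tree\<close>

text \<open>A walk is shortened to a path from its far end: if the vertex to be prepended already
  occurs, the part of the list before that occurrence is dropped.\<close>

lemma rtranclp_obtain_distinct_list:
  assumes "R\<^sup>*\<^sup>* u v"
  obtains vs where "vs \<noteq> []" "distinct vs" "hd vs = u" "last vs = v" "successively R vs"
proof -
  have "\<exists>vs. vs \<noteq> [] \<and> distinct vs \<and> hd vs = u \<and> last vs = v \<and> successively R vs"
    using assms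
  proof (induction rule: converse_rtranclp_induct)
    case base
    show ?case by (rule exI[of _ "[v]"]) simp
  next
    case (step u w)
    then obtain vs where vs: "vs \<noteq> []" "distinct vs" "hd vs = w" "last vs = v" "successively R vs"
      by blast
    show ?case
    proof (cases "u \<in> set vs")
      case True
      then obtain xs ys where "vs = xs @ u # ys" by (meson split_list)
      with vs show ?thesis
        by (intro exI[of _ "u # ys"]) (auto simp: successively_append_iff)
    next
      case False
      with vs step.hyps show ?thesis
        by (intro exI[of _ "u # vs"]) (auto simp: successively_Cons)
    qed
  qed
  then show ?thesis using that by blast
qed

text \<open>Splits off the wrap-around index, so that later only consecutive entries and the closing
  pair are checked. The closing pair is required only for length above 1, as a cycle of order 1 has
  no edges.\<close>

lemma cycle_edges_subset:
  assumes "vs \<noteq> []" "\<And>i. Suc i < length vs \<Longrightarrow> {vs ! i, vs ! Suc i} \<in> E"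
    and "length vs > 1 \<Longrightarrow> {last vs, hd vs} \<in> E"
  shows "cycle_edges vs \<subseteq> E"
proof
  fix e assume "e \<in> cycle_edges vs"
  then obtain i where i: "i < length vs" "length vs \<noteq> 1" "e = {vs ! i, vs ! (Suc i mod length vs)}"
    by (auto simp: cycle_edges_def split: if_splits)
  show "e \<in> E"
  proof (cases "Suc i < length vs")
    case True
    with i assms(2) show ?thesis by simp
  next
    case False
    with i(1) have "Suc i = length vs" by simp
    with i assms(1) have "e = {last vs, hd vs}"
      by (auto simp: last_conv_nth hd_conv_nth dest: arg_cong[of _ _ "\<lambda>n. n - 1"])
    moreover have "length vs > 1" using i(1,2) by linarith
    ultimately show ?thesis using assms(3) by simp
  qed
qed

lemma simple_graph_cycle:
  assumes "vs \<noteq> []" "distinct vs"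
  shows "simple_graph \<lparr>verts = set vs, edges = cycle_edges vs\<rparr>"
  unfolding simple_graph_def
proof (intro conjI ballI)
  fix e assume "e \<in> edges \<lparr>verts = set vs, edges = cycle_edges vs\<rparr>"
  then obtain i where i: "i < length vs" "length vs \<noteq> 1" "e = {vs ! i, vs ! (Suc i mod length vs)}"
    by (auto simp: cycle_edges_def split: if_splits)
  let ?j = "Suc i mod length vs"
  have j: "?j < length vs" using assms(1) by simp
  have "?j \<noteq> i"
  proof (cases "Suc i < length vs")
    case False
    with i have "Suc i = length vs" by simp
    with i show ?thesis by auto
  qed simp
  with i j assms have "vs ! i \<noteq> vs ! ?j" by (simp add: nth_eq_iff_index_eq)
  then show "\<exists>u\<in>verts \<lparr>verts = set vs, edges = cycle_edges vs\<rparr>.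
     \<exists>v\<in>verts \<lparr>verts = set vs, edges = cycle_edges vs\<rparr>. u \<noteq> v \<and> e = {u, v}"
    unfolding i(3) using i(1) j by (intro bexI[of _ "vs ! i"] bexI[of _ "vs ! ?j"]) auto
qed simp

text \<open>A path from \<open>u\<close> to \<open>v\<close> that avoids the edge
  \<open>{u, v}\<close> would close with it to a cycle. The path has at least three vertices,
  because with only two it would consist of the removed edge.\<close>

lemma tree_edge_is_bridge:
  assumes "is_tree T" "{u, v} \<in> edges T" "u \<noteq> v"
  shows "\<not> (adjacent \<lparr>verts = verts T, edges = edges T - {{u, v}}\<rparr>)\<^sup>*\<^sup>* u v"
proof
  let ?H = "\<lparr>verts = verts T, edges = edges T - {{u, v}}\<rparr>"
  assume "(adjacent ?H)\<^sup>*\<^sup>* u v"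
  then obtain vs where vs: "vs \<noteq> []" "distinct vs" "hd vs = u" "last vs = v"
    "successively (adjacent ?H) vs"
    by (rule rtranclp_obtain_distinct_list)
  have sT: "simple_graph T" using assms by (simp add: is_tree_def)
  have step: "{vs ! i, vs ! Suc i} \<in> edges T - {{u, v}}" if "Suc i < length vs" for i
    using successively_nth[OF vs(5) that] by (simp add: adjacent_def)
  have len: "length vs \<ge> 3"
  proof (rule ccontr)
    assume "\<not> length vs \<ge> 3"
    then consider "length vs = 0" | "length vs = 1" | "length vs = 2" by linarith
    then show False
    proof cases
      case 3
      then have "vs ! 0 = u" "vs ! Suc 0 = v"
        using vs by (auto simp: hd_conv_nth last_conv_nth)
      with step[of 0] 3 show False by simp
    qed (use vs assms(3) in \<open>auto simp: length_Suc_conv\<close>)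
  qed
  let ?C = "\<lparr>verts = set vs, edges = cycle_edges vs\<rparr>"
  have "cycle_edges vs \<subseteq> edges T"
    using vs step assms(2) by (intro cycle_edges_subset) (auto simp: insert_commute)
  moreover have "set vs \<subseteq> verts T"
  proof
    fix w assume "w \<in> set vs"
    then obtain i where i: "i < length vs" "w = vs ! i" by (auto simp: in_set_conv_nth)
    show "w \<in> verts T"
    proof (cases "Suc i < length vs")
      case True
      then have "adjacent T (vs ! i) (vs ! Suc i)" using step by (simp add: adjacent_def)
      with sT i show ?thesis using adjacent_in_verts by metis
    next
      case False
      with i vs have "w = v" by (metis Suc_lessI diff_Suc_1 last_conv_nth)
      then show ?thesis using assms(2) sT adjacent_in_verts by (metis adjacent_def)
    qed
  qed
  ultimately have "subgraph_of ?C T"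
    using simple_graph_cycle[OF vs(1,2)] by (simp add: subgraph_of_def)
  moreover have "simple_cycle ?C" using vs by (auto simp: simple_cycle_def)
  moreover have "card (verts ?C) \<ge> 3" using vs(2) len by (simp add: distinct_card)
  ultimately show False using assms(1) unfolding is_tree_def by blast
qed

text \<open>An edge that is not a parent edge could be deleted while every vertex still reaches the
  root, so it would not be a bridge.\<close>

lemma tree_edges_eq:
  assumes "is_tree T" "bfs T r d par"
  shows "edges T = (\<lambda>w. {w, par w}) ` (verts T - {r})"
proof (rule ccontr)
  assume "\<not> ?thesis"
  with bfs_parent_edges_subset[OF assms(2)]
  obtain e where e: "e \<in> edges T" "e \<notin> (\<lambda>w. {w, par w}) ` (verts T - {r})" by blast
  then obtain u v where uv: "u \<in> verts T" "v \<in> verts T" "u \<noteq> v" "e = {u, v}"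
    using assms(1) unfolding is_tree_def simple_graph_def by blast
  let ?H = "\<lparr>verts = verts T, edges = edges T - {{u, v}}\<rparr>"
  have "adjacent ?H w (par w)" if "w \<in> verts T - {r}" for w
    using bfs_parent_edges_subset[OF assms(2)] e(2) that uv(4) by (auto simp: adjacent_def)
  then have *: "(adjacent ?H)\<^sup>*\<^sup>* w r" if "w \<in> verts T" for w
    using bfs_reach_root[OF assms(2) that] by blast
  have "connected_graph ?H"
  proof (rule connected_graphI[of r])
    show "r \<in> verts ?H" using assms(2) by (simp add: bfs_def)
  qed (use * in simp)
  with uv(1,2) have "(adjacent ?H)\<^sup>*\<^sup>* u v" by (simp add: connected_graph_def)
  with tree_edge_is_bridge[OF assms(1)] uv(3,4) e(1) show False by blast
qed

lemma tree_card:
  assumes "is_tree T"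
  shows "card (verts T) = Suc (card (edges T))"
proof -
  have T: "simple_graph T" "connected_graph T" using assms by (auto simp: is_tree_def)
  obtain r where r: "r \<in> verts T" using T by (auto simp: connected_graph_def)
  obtain d par where b: "bfs T r d par" using bfs_exists[OF T r] by blast
  have "card (edges T) = card (verts T - {r})"
    using tree_edges_eq[OF assms b] bfs_inj_parent_edge[OF b] by (simp add: card_image)
  moreover have "Suc (card (verts T - {r})) = card (verts T)"
    using T(1) r by (intro card_Suc_Diff1) (auto simp: simple_graph_def)
  ultimately show ?thesis by simp
qed

text \<open>Each edge of \<open>G\<close> is replaced by a walk in \<open>H\<close>; this is how
  connectedness survives the deletion or exchange of an edge.\<close>

lemma connected_refine:
  assumes "connected_graph G" "verts H = verts G"
    and "\<And>u v. adjacent G u v \<Longrightarrow> (adjacent H)\<^sup>*\<^sup>* u v"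
  shows "connected_graph H"
  unfolding connected_graph_def
proof (intro conjI ballI)
  fix u v assume "u \<in> verts H" "v \<in> verts H"
  with assms have "(adjacent G)\<^sup>*\<^sup>* u v" by (auto simp: connected_graph_def)
  then show "(adjacent H)\<^sup>*\<^sup>* u v"
    by induction (auto intro: assms(3) rtranclp_trans)
qed (use assms in \<open>auto simp: connected_graph_def\<close>)

text \<open>Deleting an edge of a cycle keeps the graph connected but leaves fewer edges than a
  connected graph needs. Acyclicity of a modified tree thus reduces to counting edges.\<close>

lemma is_treeI:
  assumes "simple_graph T" "connected_graph T" "card (verts T) = Suc (card (edges T))"
  shows "is_tree T"
proof -
  have False if C: "subgraph_of C T" "simple_cycle C" "card (verts C) \<ge> 3" for C
  proof -
    obtain vs where vs: "vs \<noteq> []" "distinct vs" "verts C = set vs" "edges C = cycle_edges vs"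
      using C(2) by (auto simp: simple_cycle_def)
    define n where "n = length vs"
    have n: "n \<ge> 3" using C(3) vs by (simp add: distinct_card n_def)
    have ed: "{vs ! i, vs ! (Suc i mod n)} \<in> edges T" if "i < n" for i
      using C(1) vs n that unfolding subgraph_of_def cycle_edges_def n_def by auto
    let ?e = "{vs ! (n - 1), vs ! 0}"
    let ?H = "\<lparr>verts = verts T, edges = edges T - {?e}\<rparr>"
    have eT: "?e \<in> edges T" using ed[of "n - 1"] n by simp
    have "(adjacent ?H)\<^sup>*\<^sup>* (vs ! 0) (vs ! i)" if "i < n" for i
      using that
    proof (induction i)
      case (Suc i)
      have "vs ! j = vs ! l \<longleftrightarrow> j = l" if "j < n" "l < n" for j l
        using vs(2) that by (simp add: nth_eq_iff_index_eq n_def)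
      \<comment> \<open>Order at least 3 matters here: in a cycle of order 2 the first edge is
        itself the closing edge.\<close>
      then have "{vs ! i, vs ! Suc i} \<noteq> ?e"
        using Suc.prems n by (auto simp: doubleton_eq_iff)
      with ed[of i] Suc.prems have "adjacent ?H (vs ! i) (vs ! Suc i)"
        by (simp add: adjacent_def)
      with Suc show ?case by auto
    qed simp
    then have r: "(adjacent ?H)\<^sup>*\<^sup>* (vs ! 0) (vs ! (n - 1))" using n by simp
    have "symp (adjacent ?H)" by (simp add: adjacent_sym sympI)
    then have r': "(adjacent ?H)\<^sup>*\<^sup>* (vs ! (n - 1)) (vs ! 0)"
      using r by (metis symp_rtranclp sympD)
    have "connected_graph ?H"
    proof (rule connected_refine[OF assms(2)])
      fix u v assume uv: "adjacent T u v"
      show "(adjacent ?H)\<^sup>*\<^sup>* u v"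
      proof (cases "{u, v} = ?e")
        case True
        with r r' show ?thesis by (auto simp: doubleton_eq_iff)
      next
        case False
        with uv have "adjacent ?H u v" by (simp add: adjacent_def)
        then show ?thesis by blast
      qed
    qed simp
    moreover have "simple_graph ?H" using assms(1) by (auto simp: simple_graph_def)
    ultimately have "card (verts T) \<le> Suc (card (edges T - {?e}))"
      using connected_card_le by fastforce
    moreover have "card (edges T - {?e}) < card (edges T)"
      using eT simple_graph_finite_edges[OF assms(1)] by (meson card_Diff1_less)
    ultimately show False using assms(3) by simp
  qed
  then show ?thesis using assms by (auto simp: is_tree_def)
qed

section \<open>Exchanging an edge and attaching a pendant vertex\<close>

definition swap_edge :: "'a ugraph \<Rightarrow> 'a set \<Rightarrow> 'a set \<Rightarrow> 'a ugraph" where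
  "swap_edge T e f = \<lparr>verts = verts T, edges = insert f (edges T - {e})\<rparr>"

lemma verts_swap_edge [simp]: "verts (swap_edge T e f) = verts T"
  by (simp add: swap_edge_def)

text \<open>The number of edges is unchanged, and the deleted edge is replaced by the walk from
  \<open>a\<close> back to \<open>p\<close>, across the new edge to \<open>q\<close>, and on to
  \<open>b\<close>.\<close>

lemma swap_edge_tree:
  assumes "is_tree T" "{a, b} \<in> edges T" "{p, q} \<notin> edges T" "p \<noteq> q"
    and "p \<in> verts T" "q \<in> verts T"
    and "(adjacent \<lparr>verts = verts T, edges = edges T - {{a, b}}\<rparr>)\<^sup>*\<^sup>* p a"
    and "(adjacent \<lparr>verts = verts T, edges = edges T - {{a, b}}\<rparr>)\<^sup>*\<^sup>* q b"
  shows "is_tree (swap_edge T {a, b} {p, q})"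
proof -
  let ?S = "swap_edge T {a, b} {p, q}"
  let ?H = "\<lparr>verts = verts T, edges = edges T - {{a, b}}\<rparr>"
  have T: "simple_graph T" "connected_graph T" using assms by (auto simp: is_tree_def)
  have le: "(adjacent ?S)\<^sup>*\<^sup>* u v" if "(adjacent ?H)\<^sup>*\<^sup>* u v" for u v
    using that by (rule rtranclp_mono[THEN predicate2D, rotated])
      (auto simp: adjacent_def swap_edge_def)
  have "symp (adjacent ?S)" by (simp add: adjacent_sym sympI)
  then have sym: "(adjacent ?S)\<^sup>*\<^sup>* v u" if "(adjacent ?S)\<^sup>*\<^sup>* u v" for u v
    using that by (metis symp_rtranclp sympD)
  have pq: "adjacent ?S p q" by (auto simp: adjacent_def swap_edge_def)
  have ab: "(adjacent ?S)\<^sup>*\<^sup>* a b"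
    using sym[OF le[OF assms(7)]] pq le[OF assms(8)]
    by (meson r_into_rtranclp rtranclp_trans)
  have "connected_graph ?S"
  proof (rule connected_refine[OF T(2)])
    fix u v assume uv: "adjacent T u v"
    show "(adjacent ?S)\<^sup>*\<^sup>* u v"
    proof (cases "{u, v} = {a, b}")
      case True
      with ab sym[OF ab] show ?thesis by (auto simp: doubleton_eq_iff)
    next
      case False
      with uv have "adjacent ?S u v" by (simp add: adjacent_def swap_edge_def)
      then show ?thesis by blast
    qed
  qed simp
  moreover have "simple_graph ?S"
    using T(1) assms(4-6) by (auto simp: simple_graph_def swap_edge_def)
  moreover have "card (edges ?S) = card (edges T)"
    using simple_graph_finite_edges[OF T(1)] assms(2,3) card_Suc_Diff1[of "edges T" "{a, b}"]
    by (simp add: swap_edge_def)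
  ultimately show ?thesis using is_treeI tree_card[OF assms(1)] by (metis verts_swap_edge)
qed

text \<open>Written additively to avoid truncated subtraction. If \<open>v\<close> lies on both
  edges, the two corrections cancel.\<close>

lemma degree_swap_edge:
  assumes "finite (edges T)" "e \<in> edges T" "f \<notin> edges T"
  shows "degree (swap_edge T e f) v + (if v \<in> e then 1 else 0)
         = degree T v + (if v \<in> f then 1 else 0)"
proof -
  have fin: "finite {g \<in> edges T. v \<in> g}" using assms(1) by simp
  have eq: "{g \<in> edges (swap_edge T e f). v \<in> g}
      = (if v \<in> f then {f} else {}) \<union> ({g \<in> edges T. v \<in> g} - {e})"
    using assms by (auto simp: swap_edge_def)
  have "card {g \<in> edges (swap_edge T e f). v \<in> g}
      = (if v \<in> f then 1 else 0) + card ({g \<in> edges T. v \<in> g} - {e})"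
    unfolding eq using fin assms(3) by (subst card_Un_disjoint) auto
  moreover have "card ({g \<in> edges T. v \<in> g} - {e}) + (if v \<in> e then 1 else 0)
      = card {g \<in> edges T. v \<in> g}"
    using card_Suc_Diff1[OF fin, of e] assms(2) by simp
  ultimately show ?thesis by (simp add: degree_def)
qed

definition add_pendant :: "'a ugraph \<Rightarrow> 'a \<Rightarrow> 'a \<Rightarrow> 'a ugraph" where
  "add_pendant T u w = \<lparr>verts = insert w (verts T), edges = insert {u, w} (edges T)\<rparr>"

lemma add_pendant_tree:
  assumes "is_tree T" "u \<in> verts T" "w \<notin> verts T"
  shows "is_tree (add_pendant T u w)"
proof -
  let ?S = "add_pendant T u w"
  have T: "simple_graph T" "connected_graph T" using assms by (auto simp: is_tree_def)
  have nin: "{u, w} \<notin> edges T"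
    using assms(3) T(1) adjacent_in_verts(2) by (metis adjacent_def)
  have "connected_graph ?S"
  proof (rule connected_graphI[of u])
    fix v assume v: "v \<in> verts ?S"
    show "(adjacent ?S)\<^sup>*\<^sup>* v u"
    proof (cases "v = w")
      case True
      then show ?thesis by (auto simp: adjacent_def add_pendant_def insert_commute)
    next
      case False
      with v T(2) assms(2) have "(adjacent T)\<^sup>*\<^sup>* v u"
        by (auto simp: connected_graph_def add_pendant_def)
      then show ?thesis
        by (rule rtranclp_mono[THEN predicate2D, rotated])
          (auto simp: adjacent_def add_pendant_def)
    qed
  qed (use assms in \<open>simp add: add_pendant_def\<close>)
  moreover have "simple_graph ?S"
    unfolding simple_graph_def
  proof (intro conjI ballI)
    fix e assume "e \<in> edges ?S"
    then consider "e = {u, w}" | "e \<in> edges T" by (auto simp: add_pendant_def)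
    then show "\<exists>a\<in>verts ?S. \<exists>b\<in>verts ?S. a \<noteq> b \<and> e = {a, b}"
    proof cases
      case 1
      with assms(2,3) show ?thesis
        by (intro bexI[of _ u] bexI[of _ w]) (auto simp: add_pendant_def)
    next
      case 2
      with T(1) obtain a b where "a \<in> verts T" "b \<in> verts T" "a \<noteq> b" "e = {a, b}"
        unfolding simple_graph_def by blast
      then show ?thesis
        by (intro bexI[of _ a] bexI[of _ b]) (auto simp: add_pendant_def)
    qed
  qed (use T(1) in \<open>simp add: simple_graph_def add_pendant_def\<close>)
  moreover have "card (verts ?S) = Suc (card (verts T))" "card (edges ?S) = Suc (card (edges T))"
    using assms(3) nin T simple_graph_finite_edges[OF T(1)]
    by (auto simp: add_pendant_def simple_graph_def)
  ultimately show ?thesis using is_treeI tree_card[OF assms(1)] by metis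
qed

lemma degree_add_pendant:
  assumes "simple_graph T" "w \<notin> verts T"
  shows "degree (add_pendant T u w) v = degree T v + (if v \<in> {u, w} then 1 else 0)"
proof -
  have nin: "{u, w} \<notin> edges T"
    using assms adjacent_in_verts(2) by (metis adjacent_def)
  have "{g \<in> edges (add_pendant T u w). v \<in> g}
      = (if v \<in> {u, w} then insert {u, w} {g \<in> edges T. v \<in> g} else {g \<in> edges T. v \<in> g})"
    by (auto simp: add_pendant_def)
  then show ?thesis
    using nin simple_graph_finite_edges[OF assms(1)] by (auto simp: degree_def)
qed

section \<open>Leaves, degrees and root paths in a tree\<close>

text \<open>A vertex at maximal level has no children, so its parent is its only neighbour.
  Excluding the root allows a second leaf to be found by rooting at a first one.\<close>

lemma tree_obtain_leaf:
  assumes "is_tree T" "r \<in> verts T" "card (verts T) \<ge> 2"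
  obtains v where "v \<in> leaves T" "v \<noteq> r"
proof -
  have T: "simple_graph T" "connected_graph T" using assms by (auto simp: is_tree_def)
  have fin: "finite (verts T)" using T by (simp add: simple_graph_def)
  obtain d par where b: "bfs T r d par" using bfs_exists[OF T assms(2)] by blast
  have "verts T - {r} \<noteq> {}"
  proof
    assume "verts T - {r} = {}"
    then have "card (verts T) \<le> card {r}" by (intro card_mono) auto
    with assms(3) show False by simp
  qed
  then have "Max (d ` (verts T - {r})) \<in> d ` (verts T - {r})"
    using fin by (intro Max_in) auto
  then obtain v where v: "v \<in> verts T - {r}" "d v = Max (d ` (verts T - {r}))"
    by (metis imageE)
  then have v_max: "d w \<le> d v" if "w \<in> verts T - {r}" for w
    using fin that by simp
  have "nbrs T v = {par v}"
  proof (intro equalityI subsetI)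
    fix w assume "w \<in> nbrs T v"
    then have "{v, w} \<in> edges T" by (simp add: nbrs_def adjacent_def)
    then obtain z where z: "z \<in> verts T - {r}" "{v, w} = {z, par z}"
      using tree_edges_eq[OF assms(1) b] by auto
    have "d z = Suc (d (par z))" using b z(1) by (auto simp: bfs_def)
    with v_max[OF z(1)] have "par z \<noteq> v" by auto
    with z(2) show "w \<in> {par v}" by (auto simp: doubleton_eq_iff)
  next
    fix w assume "w \<in> {par v}"
    with b v(1) show "w \<in> nbrs T v" by (auto simp: bfs_def nbrs_def intro: adjacent_sym)
  qed
  then have "degree T v = 1" by (simp add: degree_eq_card_nbrs[OF T(1)])
  with v(1) show ?thesis by (intro that[of v]) (auto simp: leaves_def)
qed

text \<open>Otherwise there is a leaf, and rooting at that leaf yields another one.\<close>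

lemma tree_few_leaves_single:
  assumes "is_tree T" "card (leaves T) \<le> 1"
  shows "card (verts T) = 1"
proof (rule ccontr)
  assume n1: "card (verts T) \<noteq> 1"
  have fin: "finite (verts T)" using assms by (simp add: is_tree_def simple_graph_def)
  obtain r where r: "r \<in> verts T" using assms by (auto simp: is_tree_def connected_graph_def)
  then have "card (verts T) \<noteq> 0" using fin by auto
  with n1 have n2: "card (verts T) \<ge> 2" by linarith
  obtain v where v: "v \<in> leaves T" using tree_obtain_leaf[OF assms(1) r n2] by blast
  then have "v \<in> verts T" by (simp add: leaves_def)
  then obtain w where w: "w \<in> leaves T" "w \<noteq> v" using tree_obtain_leaf[OF assms(1) _ n2] by blast
  have "finite (leaves T)" using fin by (simp add: leaves_def)
  then have "card {v, w} \<le> card (leaves T)" using v w by (intro card_mono) auto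
  with w assms(2) show False by simp
qed


lemma tree_degree_pos:
  assumes "is_tree T" "v \<in> verts T" "card (verts T) \<noteq> 1"
  shows "degree T v \<noteq> 0"
proof -
  have T: "simple_graph T" "connected_graph T" using assms by (auto simp: is_tree_def)
  have "verts T \<noteq> {v}" using assms(3) by auto
  then obtain r where r: "r \<in> verts T" "r \<noteq> v" using assms(2) by blast
  obtain d par where "bfs T r d par" using bfs_exists[OF T r(1)] by blast
  then have "adjacent T (par v) v" using assms(2) r(2) by (auto simp: bfs_def)
  then have "{par v} \<subseteq> nbrs T v" by (auto simp: nbrs_def intro: adjacent_sym)
  from card_le_degree[OF T(1) this] show ?thesis by simp
qed

text \<open>The root path of \<open>par z\<close> uses parent edges of vertices at level at most
  \<open>d (par z)\<close>, whereas the deleted edge belongs to \<open>z\<close>, one level further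
  out.\<close>

lemma bfs_root_reaches_parent:
  assumes "bfs T r d par" "z \<in> verts T - {r}"
  shows "(adjacent \<lparr>verts = verts T, edges = edges T - {{par z, z}}\<rparr>)\<^sup>*\<^sup>* r (par z)"
proof -
  let ?H = "\<lparr>verts = verts T, edges = edges T - {{par z, z}}\<rparr>"
  have z: "par z \<in> verts T" "d z = Suc (d (par z))" using assms by (auto simp: bfs_def)
  have "adjacent ?H w (par w)" if w: "w \<in> verts T - {r}" "d w \<le> d (par z)" for w
  proof -
    have "d w = Suc (d (par w))" using assms(1) w(1) by (auto simp: bfs_def)
    then have "{w, par w} \<noteq> {par z, z}"
      using w(2) z(2) by (auto simp: doubleton_eq_iff)
    then show ?thesis
      using bfs_parent_edges_subset[OF assms(1)] w(1) by (auto simp: adjacent_def)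
  qed
  then have "(adjacent ?H)\<^sup>*\<^sup>* (par z) r"
    using bfs_reach_root[OF assms(1) z(1)] by blast
  moreover have "symp (adjacent ?H)" by (simp add: adjacent_sym sympI)
  ultimately show ?thesis by (metis symp_rtranclp sympD)
qed

section \<open>Largest trees with a bounded number of leaves\<close>

text \<open>Genuine trees only, so that no case distinction on the convention for 1-ended trees
  arises. It is applied with \<open>m = k + 1\<close>, which is at least 2.\<close>

definition largest_tree :: "nat \<Rightarrow> 'a ugraph \<Rightarrow> 'a ugraph \<Rightarrow> bool" where
  "largest_tree m G T \<longleftrightarrow> subgraph_of T G \<and> is_tree T \<and> card (leaves T) \<le> m \<and>
     (\<forall>T'. subgraph_of T' G \<longrightarrow> is_tree T' \<longrightarrow> card (leaves T') \<le> m \<longrightarrow>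
       card (verts T') \<le> card (verts T))"

definition has_spanning_ended_tree :: "nat \<Rightarrow> 'a ugraph \<Rightarrow> bool" where
  "has_spanning_ended_tree k G \<longleftrightarrow> (\<exists>T. spanning_subgraph T G \<and> ended_tree k T)"

lemma finite_leaves: "is_tree T \<Longrightarrow> finite (leaves T)"
  by (simp add: is_tree_def simple_graph_def leaves_def)

text \<open>Attaching \<open>w\<close> at \<open>u\<close> would give a larger admissible tree:
  \<open>w\<close> becomes a leaf and \<open>u\<close> is none, having had positive degree before.
  If \<open>T\<close> is a single vertex, \<open>u\<close> does become a leaf, but two leaves are
  allowed.\<close>

lemma largest_tree_no_exit:
  assumes "largest_tree m G T" "2 \<le> m" "simple_graph G"
    and "u \<in> verts T" "adjacent G u w" "w \<notin> verts T"
    and "card (insert w (leaves T - {u})) \<le> m"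
  shows False
proof -
  let ?S = "add_pendant T u w"
  have T: "is_tree T" "simple_graph T" "subgraph_of T G"
    using assms(1) by (auto simp: largest_tree_def is_tree_def)
  have S: "is_tree ?S" using add_pendant_tree[OF T(1) assms(4,6)] .
  have "w \<in> verts G" using adjacent_in_verts[OF assms(3,5)] by simp
  then have sub: "subgraph_of ?S G"
    using T(3) S assms(5) by (auto simp: subgraph_of_def is_tree_def add_pendant_def adjacent_def)
  have fin: "finite (verts T)" using T by (simp add: simple_graph_def)
  have cS: "card (verts ?S) = Suc (card (verts T))"
    using fin assms(6) by (simp add: add_pendant_def)
  have "card (leaves ?S) \<le> m"
  proof (cases "card (verts T) = 1")
    case True
    have "card (leaves ?S) \<le> card (verts ?S)"
      using fin by (intro card_mono) (auto simp: leaves_def add_pendant_def)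
    with True cS assms(2) show ?thesis by simp
  next
    case False
    have "leaves ?S \<subseteq> insert w (leaves T - {u})"
    proof
      fix v assume v: "v \<in> leaves ?S"
      then have "degree T v + (if v \<in> {u, w} then 1 else 0) = 1" "v \<in> insert w (verts T)"
        using degree_add_pendant[OF T(2) assms(6), of u v] by (auto simp: leaves_def add_pendant_def)
      with tree_degree_pos[OF T(1) assms(4) False] show "v \<in> insert w (leaves T - {u})"
        by (auto simp: leaves_def split: if_splits)
    qed
    then have "card (leaves ?S) \<le> card (insert w (leaves T - {u}))"
      using finite_leaves[OF T(1)] by (intro card_mono) auto
    with assms(7) show ?thesis by simp
  qed
  then have "card (verts ?S) \<le> card (verts T)"
    using assms(1) S sub by (simp add: largest_tree_def)
  with cS show False by simp
qed

text \<open>A pendant edge at a leaf \<open>u\<close> merely trades the leaf \<open>u\<close> for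
  the leaf \<open>w\<close>.\<close>

lemma largest_tree_leaf_no_exit:
  assumes "largest_tree m G T" "2 \<le> m" "simple_graph G" "u \<in> leaves T" "adjacent G u w"
  shows "w \<in> verts T"
proof (rule ccontr)
  assume w: "w \<notin> verts T"
  have T: "is_tree T" "card (leaves T) \<le> m" using assms(1) by (auto simp: largest_tree_def)
  have "card (insert w (leaves T - {u})) \<le> m"
    using card_insert_le_m1[of "m" "leaves T - {u}" w] card_Suc_Diff1[OF finite_leaves[OF T(1)] assms(4)]
      T(2) assms(2) by simp
  then show False
    using largest_tree_no_exit[OF assms(1-3) _ assms(5) w] assms(4) by (simp add: leaves_def)
qed

text \<open>There is room for one more leaf, so no edge of \<open>G\<close> leaves \<open>T\<close>
  and \<open>T\<close> spans. For \<open>k = 1\<close> the tree is then a single vertex, which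
  counts as a cycle of order 1.\<close>

lemma largest_tree_few_leaves:
  assumes "largest_tree (k + 1) G T" "k \<ge> 1" "simple_graph G" "connected_graph G"
    and "card (leaves T) \<le> k"
  shows "has_spanning_ended_tree k G"
proof -
  have T: "is_tree T" "simple_graph T" "connected_graph T" "subgraph_of T G"
    using assms(1) by (auto simp: largest_tree_def is_tree_def)
  have "verts T = verts G"
  proof (rule adjacent_closed_eq_verts[OF assms(4)])
    fix u v assume uv: "u \<in> verts T" "adjacent G u v"
    have "card (insert v (leaves T - {u})) \<le> Suc (card (leaves T - {u}))"
      by (rule card_insert_le_m1) auto
    also have "\<dots> \<le> k + 1"
      using assms(5) card_mono[OF finite_leaves[OF T(1)], of "leaves T - {u}"] by simp
    finally show "v \<in> verts T"
      using largest_tree_no_exit[OF assms(1) _ assms(3) uv] assms(2) by auto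
  qed (use T in \<open>auto simp: subgraph_of_def connected_graph_def\<close>)
  with T(4) have span: "spanning_subgraph T G" by (simp add: spanning_subgraph_def)
  have "ended_tree k T"
  proof (cases "k = 1")
    case True
    with assms(5) T(1) have c1: "card (verts T) = 1" using tree_few_leaves_single by blast
    then obtain v where v: "verts T = {v}" by (auto simp: card_1_singleton_iff)
    have "edges T = {}" using tree_card[OF T(1)] c1 simple_graph_finite_edges[OF T(2)] by simp
    with v have "simple_cycle T"
      unfolding simple_cycle_def by (intro exI[of _ "[v]"]) (simp add: cycle_edges_def)
    with True show ?thesis by (simp add: ended_tree_def)
  next
    case False
    with T assms(5) show ?thesis by (simp add: ended_tree_def)
  qed
  with span show ?thesis by (auto simp: has_spanning_ended_tree_def)
qed

lemma largest_tree_swap_edge: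
  assumes "largest_tree m G T" "is_tree (swap_edge T e f)" "f \<in> edges G"
    and "card (leaves (swap_edge T e f)) \<le> m"
  shows "largest_tree m G (swap_edge T e f)"
  using assms by (auto simp: largest_tree_def subgraph_of_def is_tree_def swap_edge_def)

text \<open>The tree path between \<open>x\<close> and \<open>y\<close> closes with the edge
  \<open>{x, y}\<close>, and any edge of this cycle may be dropped. Next to a branch vertex this
  leaves at most \<open>k\<close> leaves. Without a branch vertex on the path, \<open>T\<close> is
  that path and the cycle runs through all of it.\<close>

lemma largest_tree_adjacent_leaves:
  assumes "largest_tree (k + 1) G T" "k \<ge> 1" "simple_graph G" "connected_graph G"
    and "x \<in> leaves T" "y \<in> leaves T" "x \<noteq> y" "adjacent G x y"
  shows "has_spanning_ended_tree k G"
proof -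
  have T: "is_tree T" "simple_graph T" "connected_graph T" "subgraph_of T G"
    "card (leaves T) \<le> k + 1"
    using assms(1) by (auto simp: largest_tree_def is_tree_def)
  have x: "x \<in> verts T" "degree T x = 1" and y: "y \<in> verts T" "degree T y = 1"
    using assms(5,6) by (auto simp: leaves_def)
  have finE: "finite (edges T)" using simple_graph_finite_edges T(2) by blast
  obtain d par where b: "bfs T x d par" using bfs_exists[OF T(2,3) x(1)] by blast
  have par: "par v \<in> verts T" "adjacent T (par v) v" "d v = Suc (d (par v))"
    if "v \<in> verts T" "v \<noteq> x" for v
    using b that unfolding bfs_def by blast+
  have dx: "d x = 0" using b by (simp add: bfs_def)
  define n where "n = d y"
  \<comment> \<open>The tree path from \<open>y\<close> up to the root \<open>x\<close>; it arrives
    after exactly \<open>n = d y\<close> steps, since each step lowers the level by one.\<close>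
  define c where "c i = (par ^^ i) y" for i
  have c0: "c 0 = y" and c_Suc: "c (Suc i) = par (c i)" for i by (auto simp: c_def)
  have c: "c i \<in> verts T \<and> d (c i) = n - i" if "i \<le> n" for i
    using that
  proof (induction i)
    case (Suc i)
    then have "c i \<in> verts T" "d (c i) = n - i" by auto
    moreover have "c i \<noteq> x" using calculation Suc.prems dx by auto
    ultimately show ?case using par[of "c i"] Suc.prems by (simp add: c_Suc)
  qed (use y in \<open>simp add: c0 n_def\<close>)
  have c_ne_x: "c i \<noteq> x" if "i < n" for i using c[of i] that dx by auto
  have cn: "c n = x" using c[of n] par(3)[of "c n"] by fastforce
  have c_inj: "i = j" if "c i = c j" "i \<le> n" "j \<le> n" for i j
    using c[of i] c[of j] that by (metis diff_diff_cancel)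
  have c_edge: "adjacent T (c i) (c (Suc i))" if "i < n" for i
    using par(2)[of "c i"] c[of i] c_ne_x[OF that] that by (auto simp: c_Suc intro: adjacent_sym)
  have n0: "n \<noteq> 0" using cn c0 assms(7) by metis

  \<comment> \<open>Two adjacent leaves of \<open>T\<close> would be all of \<open>T\<close>,
    leaving no place for the inner vertex \<open>c i\<close>.\<close>
  have xy_not_edge: "{x, y} \<notin> edges T" if "i < n" "0 < i" for i
  proof
    assume "{x, y} \<in> edges T"
    then have "{y} \<subseteq> nbrs T x" "{x} \<subseteq> nbrs T y"
      by (auto simp: nbrs_def adjacent_def insert_commute)
    then have "nbrs T x = {y}" "nbrs T y = {x}"
      using nbrs_eqI[OF T(2)] x(2) y(2) by auto
    then have "{x, y} = verts T"
      using x(1) y(1) by (intro adjacent_closed_eq_verts[OF T(3)]) (auto simp: nbrs_def)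
    then show False
      using c[of i] c_ne_x[of i] c_inj[of i 0] c0 that by auto
  qed
  \<comment> \<open>Deleting the edge above \<open>c i\<close> separates \<open>x\<close>, on the
    side of \<open>c (Suc i)\<close>, from \<open>y\<close>, on the side of \<open>c i\<close>; the
    new edge rejoins them. If \<open>Suc i = n\<close>, then \<open>c (Suc i)\<close> is
    \<open>x\<close>, which stays a leaf and is covered by the inserted element.\<close>
  have swap: "is_tree (swap_edge T {c (Suc i), c i} {x, y})"
    "leaves (swap_edge T {c (Suc i), c i} {x, y}) \<subseteq>
       insert (c (Suc i)) (leaves T - {x, y}) \<union> (if degree T (c i) = 2 then {c i} else {})"
    if i: "i < n" "0 < i" for i
  proof -
    let ?H = "\<lparr>verts = verts T, edges = edges T - {{c (Suc i), c i}}\<rparr>"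
    let ?S = "swap_edge T {c (Suc i), c i} {x, y}"
    have e: "{c (Suc i), c i} \<in> edges T"
      using c_edge[OF i(1)] by (simp add: adjacent_def insert_commute)
    have "(adjacent ?H)\<^sup>*\<^sup>* x (c (Suc i))"
      using bfs_root_reaches_parent[OF b, of "c i"] c[of i] c_ne_x[OF i(1)] i(1) by (simp add: c_Suc)
    moreover have "(adjacent ?H)\<^sup>*\<^sup>* y (c j)" if "j \<le> i" for j
      using that
    proof (induction j)
      case (Suc j)
      have "{c j, c (Suc j)} \<noteq> {c (Suc i), c i}"
        using c_inj[of j i] c_inj[of j "Suc i"] Suc.prems i by (auto simp: doubleton_eq_iff)
      then have "adjacent ?H (c j) (c (Suc j))"
        using c_edge[of j] Suc.prems i by (simp add: adjacent_def)
      with Suc show ?case by (meson Suc_leD rtranclp.rtrancl_into_rtrancl)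
    qed (simp add: c0)
    ultimately show "is_tree ?S"
      using swap_edge_tree[OF T(1) e xy_not_edge[OF i] assms(7) x(1) y(1)] by blast
    have ci: "c i \<notin> {x, y}" using c_ne_x[OF i(1)] c_inj[of i 0] c0 i by auto
    show "leaves ?S \<subseteq>
       insert (c (Suc i)) (leaves T - {x, y}) \<union> (if degree T (c i) = 2 then {c i} else {})"
    proof
      fix v assume v: "v \<in> leaves ?S"
      then have "1 + (if v \<in> {c (Suc i), c i} then 1 else 0)
          = degree T v + (if v \<in> {x, y} then 1 else 0)" "v \<in> verts T"
        using degree_swap_edge[OF finE e xy_not_edge[OF i], of v] by (auto simp: leaves_def)
      with ci x(2) y(2) show "v \<in> insert (c (Suc i)) (leaves T - {x, y}) \<union>
          (if degree T (c i) = 2 then {c i} else {})"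
        by (auto simp: leaves_def split: if_splits)
    qed
  qed
  \<comment> \<open>Two leaves are removed from at most \<open>k + 1\<close> and at most one vertex
    is added. For this bound \<open>k\<close> must be at least 1.\<close>
  have card_swap: "card (insert (c (Suc i)) (leaves T - {x, y})) \<le> k" for i
  proof -
    have "card (leaves T - {x, y}) = card (leaves T) - 2"
      using assms(5-7) by (subst card_Diff_subset) auto
    moreover have "card (insert (c (Suc i)) (leaves T - {x, y})) \<le> Suc (card (leaves T - {x, y}))"
      by (rule card_insert_le_m1) auto
    ultimately show ?thesis using T(5) assms(2) by linarith
  qed
  have xyG: "{x, y} \<in> edges G" using assms(8) by (simp add: adjacent_def)
  have inner: "0 < i \<and> i < n" if "i \<le> n" "degree T (c i) \<noteq> 1" for i
    using that x(2) y(2) c0 cn by (metis gr0I le_neq_implies_less)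
  show ?thesis
  proof (cases "\<exists>i\<le>n. degree T (c i) \<ge> 3")
    case True
    then obtain i where i: "i \<le> n" "degree T (c i) \<ge> 3" by blast
    with inner have i': "0 < i" "i < n" by auto
    let ?S = "swap_edge T {c (Suc i), c i} {x, y}"
    have "leaves ?S \<subseteq> insert (c (Suc i)) (leaves T - {x, y})"
      using swap(2)[OF i'(2,1)] i(2) by auto
    then have "card (leaves ?S) \<le> card (insert (c (Suc i)) (leaves T - {x, y}))"
      using finite_leaves[OF T(1)] by (intro card_mono) auto
    with card_swap have le: "card (leaves ?S) \<le> k" by (meson le_trans)
    then have "largest_tree (k + 1) G ?S"
      using largest_tree_swap_edge[OF assms(1) swap(1)[OF i'(2,1)] xyG] by simp
    then show ?thesis using largest_tree_few_leaves assms(2-4) le by blast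
  next
    case False
    have deg2: "degree T (c i) \<le> 2" if "i \<le> n" for i
      using False that by fastforce
    have nb0: "nbrs T (c 0) = {c 1}"
      using c_edge[of 0] n0 y(2) by (intro nbrs_eqI[OF T(2)]) (auto simp: nbrs_def c0)
    have nbn: "nbrs T (c n) = {c (n - 1)}"
      using adjacent_sym[OF c_edge[of "n - 1"]] n0 x(2)
      by (intro nbrs_eqI[OF T(2)]) (auto simp: nbrs_def cn)
    have nbi: "nbrs T (c i) = {c (i - 1), c (Suc i)}" if "0 < i" "i < n" for i
    proof (rule nbrs_eqI[OF T(2)])
      have "c (i - 1) \<noteq> c (Suc i)" using c_inj[of "i - 1" "Suc i"] that by fastforce
      then show "degree T (c i) \<le> card {c (i - 1), c (Suc i)}" using deg2[of i] that by simp
      show "{c (i - 1), c (Suc i)} \<subseteq> nbrs T (c i)"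
        using c_edge[of i] adjacent_sym[OF c_edge[of "i - 1"]] that by (auto simp: nbrs_def)
    qed
    \<comment> \<open>All neighbours in \<open>T\<close> of path vertices are on the path, so
      connectedness makes the path the whole tree.\<close>
    have V: "c ` {..n} = verts T"
    proof (rule adjacent_closed_eq_verts[OF T(3)])
      fix u v assume "u \<in> c ` {..n}" "adjacent T u v"
      then obtain i where i: "i \<le> n" "v \<in> nbrs T (c i)" by (auto simp: nbrs_def)
      consider "i = 0" | "i = n" | "0 < i" "i < n" using i(1) by linarith
      then show "v \<in> c ` {..n}"
        using i(2) nb0 nbn nbi[of i] n0 by cases auto
    qed (use c in auto)
    have deg_inner: "degree T (c i) = 2" if "0 < i" "i < n" for i
    proof -
      have "c (i - 1) \<noteq> c (Suc i)" using c_inj[of "i - 1" "Suc i"] that by fastforce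
      then show ?thesis by (simp add: degree_eq_card_nbrs[OF T(2)] nbi[OF that])
    qed
    have L: "leaves T = {x, y}"
    proof (intro equalityI subsetI)
      fix v assume v: "v \<in> leaves T"
      then obtain i where i: "i \<le> n" "v = c i" using V by (auto simp: leaves_def)
      with v deg_inner[of i] show "v \<in> {x, y}"
        using c0 cn by (cases "0 < i \<and> i < n") (auto simp: leaves_def)
    qed (use assms(5,6) in auto)
    show ?thesis
    proof (cases "k = 1")
      case False
      with assms(2,7) L have "card (leaves T) \<le> k" by simp
      then show ?thesis using largest_tree_few_leaves assms(1-4) by blast
    next
      case True
      have span: "verts T = verts G"
      proof (rule adjacent_closed_eq_verts[OF assms(4)])
        fix u w assume u: "u \<in> verts T" and uw: "adjacent G u w"
        then obtain i where i: "i \<le> n" "u = c i" using V by auto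
        show "w \<in> verts T"
        proof (cases "0 < i \<and> i < n")
          case False
          with i c0 cn assms(5,6) have "u \<in> leaves T" by (metis gr0I le_neq_implies_less)
          then show ?thesis using largest_tree_leaf_no_exit[OF assms(1)] assms(2,3) uw by simp
        next
          case inn: True
          \<comment> \<open>Rotation of the path: the cycle is cut at the edge from
            \<open>c i\<close> to \<open>c (Suc i)\<close>, which gives another largest tree in
            which \<open>u\<close> is an end. Leaves have no neighbour outside, so the cycle spans
            \<open>G\<close>.\<close>
          let ?S = "swap_edge T {c (Suc i), c i} {x, y}"
          have "leaves ?S \<subseteq> {c (Suc i), c i}"
            using swap(2)[of i] inn L by (auto split: if_splits)
          then have "card (leaves ?S) \<le> card {c (Suc i), c i}" by (intro card_mono) auto
          also have "\<dots> \<le> k + 1" using True by (simp add: card_insert_if)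
          finally have S: "largest_tree (k + 1) G ?S"
            using largest_tree_swap_edge[OF assms(1) swap(1) xyG] inn by simp
          have "c i \<notin> {x, y}" using c_ne_x[of i] c_inj[of i 0] c0 inn by auto
          then have "degree ?S (c i) = 1"
            using degree_swap_edge[OF finE _ xy_not_edge, of "{c (Suc i), c i}" i "c i"]
              c_edge[of i] inn deg_inner[of i] by (simp add: adjacent_def insert_commute)
          with u i have "u \<in> leaves ?S" by (simp add: leaves_def)
          then show ?thesis
            using largest_tree_leaf_no_exit[OF S] assms(2,3) uw by simp
        qed
      qed (use T in \<open>auto simp: subgraph_of_def connected_graph_def\<close>)
      \<comment> \<open>The path from \<open>y\<close> to \<open>x\<close>, closed by the edge
        \<open>{x, y}\<close>, is the Hamilton cycle; for \<open>n = 1\<close> it is the degenerate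
        cycle of order 2.\<close>
      define vs where "vs = map c [0..<Suc n]"
      let ?C = "\<lparr>verts = set vs, edges = cycle_edges vs\<rparr>"
      have vs: "vs \<noteq> []" "distinct vs"
        using c_inj by (auto simp: vs_def distinct_map inj_on_def simp del: upt_Suc)
      have set_vs: "set vs = verts G" using V span
        by (simp add: vs_def atLeast0LessThan lessThan_Suc_atMost del: upt_Suc)
      have "cycle_edges vs \<subseteq> edges G"
      proof (rule cycle_edges_subset[OF vs(1)])
        fix i assume "Suc i < length vs"
        then have "i < n" "vs ! i = c i" "vs ! Suc i = c (Suc i)"
          by (auto simp: vs_def simp del: upt_Suc)
        with c_edge[of i] T(4) show "{vs ! i, vs ! Suc i} \<in> edges G"
          by (auto simp: adjacent_def subgraph_of_def)
      next
        have "last vs = x" "hd vs = y"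
          using vs(1) by (simp_all add: last_conv_nth hd_conv_nth vs_def cn c0 del: upt_Suc)
        with xyG show "{last vs, hd vs} \<in> edges G" by simp
      qed
      then have "spanning_subgraph ?C G"
        using simple_graph_cycle[OF vs] set_vs by (simp add: spanning_subgraph_def subgraph_of_def)
      moreover have "ended_tree k ?C"
        using vs True by (auto simp: ended_tree_def simple_cycle_def)
      ultimately show ?thesis by (auto simp: has_spanning_ended_tree_def)
    qed
  qed
qed

section \<open>Degree sums and the counting argument\<close>

text \<open>The pair is independent, so the finite branch of \<open>sigma2\<close> applies, and its
  minimum ranges over a finite set containing this sum.\<close>

lemma sigma2_le_degree_sum:
  assumes "simple_graph G" "x \<in> verts G" "y \<in> verts G" "x \<noteq> y" "\<not> adjacent G x y"
  shows "sigma2 G \<le> ereal (real (degree G x + degree G y))"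
proof -
  have fin: "finite (verts G)" using assms(1) by (simp add: simple_graph_def)
  have "independent_set G {x, y}"
    using assms adjacent_in_verts(3)[OF assms(1)] adjacent_sym[of G y x]
    by (auto simp: independent_set_def)
  moreover have "finite {card S | S. independent_set G S}"
    using fin by (auto simp: independent_set_def
        intro: finite_subset[OF _ finite_imageI[of "Pow (verts G)" card]])
  ultimately have "card {x, y} \<le> independence_number G"
    unfolding independence_number_def by (intro Max_ge) auto
  then have i2: "independence_number G \<ge> 2" using assms(4) by simp
  let ?A = "{degree G x + degree G y | x y.
      x \<in> verts G \<and> y \<in> verts G \<and> x \<noteq> y \<and> \<not> adjacent G x y}"
  have "?A \<subseteq> (\<lambda>(x, y). degree G x + degree G y) ` (verts G \<times> verts G)" by auto
  then have "finite ?A" using fin by (meson finite_SigmaI finite_imageI finite_subset)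
  then have "Min ?A \<le> degree G x + degree G y" using assms by (intro Min_le) auto
  with i2 show ?thesis by (simp add: sigma2_def)
qed

text \<open>The parents of the neighbours of \<open>x\<close> and the neighbours of \<open>y\<close>
  form disjoint sets. Both lie in \<open>T\<close> and avoid the \<open>k\<close> leaves other than
  \<open>x\<close>.\<close>

lemma largest_tree_degree_sum:
  assumes "largest_tree (k + 1) G T" "k \<ge> 1" "simple_graph G" "connected_graph G"
    and "\<not> has_spanning_ended_tree k G"
  obtains x y where "x \<in> verts G" "y \<in> verts G" "x \<noteq> y" "\<not> adjacent G x y"
    and "degree G x + degree G y + k \<le> card (verts T)"
proof -
  have T: "is_tree T" "simple_graph T" "connected_graph T" "subgraph_of T G"
    "card (leaves T) \<le> k + 1"
    using assms(1) by (auto simp: largest_tree_def is_tree_def)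
  have finL: "finite (leaves T)" using finite_leaves T(1) .
  have finV: "finite (verts T)" using T(2) by (simp add: simple_graph_def)
  have "\<not> card (leaves T) \<le> k" using largest_tree_few_leaves[OF assms(1-4)] assms(5) by blast
  with T(5) have cL: "card (leaves T) = k + 1" by simp
  then obtain x where xL: "x \<in> leaves T"
    by (metis add_is_0 card.empty ex_in_conv one_neq_zero)
  have cLx: "card (leaves T - {x}) = k" using cL xL by simp
  with assms(2) have "leaves T - {x} \<noteq> {}" by (metis card.empty not_one_le_zero)
  then obtain y where yL: "y \<in> leaves T" "y \<noteq> x" by blast
  \<comment> \<open>Stated for every largest tree, because it is also applied after an edge
    exchange.\<close>
  have no_adj: "\<not> adjacent G u v"
    if "largest_tree (k + 1) G S" "u \<in> leaves S" "v \<in> leaves S" "u \<noteq> v" for S u v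
    using largest_tree_adjacent_leaves[OF that(1) assms(2-4) that(2-4)] assms(5) by blast
  have nxy: "\<not> adjacent G x y" using no_adj[OF assms(1) xL yL(1)] yL(2) by simp
  have x: "x \<in> verts T" "degree T x = 1" and y: "y \<in> verts T" "degree T y = 1"
    using xL yL by (auto simp: leaves_def)
  have finE: "finite (edges T)" using simple_graph_finite_edges T(2) by blast
  have sub: "nbrs G u \<subseteq> verts T" if "u \<in> leaves T" for u
    using largest_tree_leaf_no_exit[OF assms(1) _ assms(3) that] assms(2) by (auto simp: nbrs_def)
  obtain d par where b: "bfs T x d par" using bfs_exists[OF T(2,3) x(1)] by blast
  have par: "par v \<in> verts T" "adjacent T (par v) v" "d v = Suc (d (par v))"
    if "v \<in> verts T" "v \<noteq> x" for v
    using b that unfolding bfs_def by blast+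
  have nx: "z \<in> verts T" "z \<noteq> x" "z \<noteq> y" if "z \<in> nbrs G x" for z
    using that sub[OF xL] nxy adjacent_in_verts(3)[OF assms(3)] by (auto simp: nbrs_def)
  \<comment> \<open>The exception \<open>par z = x\<close> is the neighbour of the root in
    \<open>T\<close>: there no exchange is possible, and \<open>x\<close> is not adjacent to
    \<open>y\<close> anyway.\<close>
  have key: "par z \<notin> nbrs G y \<and> (par z = x \<or> degree T (par z) = 2)" if z: "z \<in> nbrs G x" for z
  proof (cases "par z = x")
    case True
    then show ?thesis using nxy adjacent_sym[of G y x] by (auto simp: nbrs_def)
  next
    case False
    note zV = nx[OF z]
    let ?p = "par z"
    let ?S = "swap_edge T {?p, z} {x, z}"
    have e: "{?p, z} \<in> edges T" using par(2)[OF zV(1,2)] by (simp add: adjacent_def)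
    have dz: "d z = Suc (d ?p)" "d ?p \<noteq> 0"
      using par(3)[OF zV(1,2)] par(3)[OF par(1)[OF zV(1,2)] False] by auto
    \<comment> \<open>A tree edge \<open>{x, z}\<close> would put \<open>z\<close> at level at most
      1, but the parent of \<open>z\<close> is not the root.\<close>
    have f: "{x, z} \<notin> edges T"
    proof
      assume "{x, z} \<in> edges T"
      then have "d z \<le> Suc (d x)" using b x(1) by (auto simp: bfs_def adjacent_def)
      with dz b show False by (simp add: bfs_def)
    qed
    have "{z, par ?p} \<subseteq> nbrs T ?p"
      using par(2)[OF zV(1,2)] adjacent_sym[OF par(2)[OF par(1)[OF zV(1,2)] False]]
      by (auto simp: nbrs_def)
    moreover have "z \<noteq> par ?p" using dz par(3)[OF par(1)[OF zV(1,2)] False] by auto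
    ultimately have deg_p: "degree T ?p \<ge> 2" using card_le_degree[OF T(2), of "{z, par ?p}" ?p] by simp
    have S: "is_tree ?S"
      using bfs_root_reaches_parent[OF b, of z] zV
      by (intro swap_edge_tree[OF T(1) e f _ x(1) zV(1)]) auto
    have deg: "degree ?S v + (if v \<in> {?p, z} then 1 else 0)
        = degree T v + (if v \<in> {x, z} then 1 else 0)" for v
      by (rule degree_swap_edge[OF finE e f])
    have pz: "?p \<noteq> z" using dz by auto
    \<comment> \<open>The exchange raises the degree of \<open>x\<close> to 2, keeps that of
      \<open>z\<close> and lowers that of \<open>?p\<close>, so \<open>?p\<close> is the only
      possible new leaf.\<close>
    have leaf: "v \<in> leaves T - {x} \<or> v = ?p \<and> degree T ?p = 2" if "v \<in> leaves ?S" for v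
      using that deg[of v] x(2) zV(2) False pz by (auto simp: leaves_def split: if_splits)
    have xzG: "{x, z} \<in> edges G" using z by (simp add: nbrs_def adjacent_def)
    \<comment> \<open>Otherwise the exchange loses the leaf \<open>x\<close> without gaining one,
      and a largest tree with at most \<open>k\<close> leaves yields a spanning one.\<close>
    have deg_p2: "degree T ?p = 2"
    proof (rule ccontr)
      assume "degree T ?p \<noteq> 2"
      then have "leaves ?S \<subseteq> leaves T - {x}" using leaf by fast
      then have "card (leaves ?S) \<le> card (leaves T - {x})"
        using finL by (intro card_mono) auto
      with cLx have le: "card (leaves ?S) \<le> k" by simp
      then have "largest_tree (k + 1) G ?S"
        using largest_tree_swap_edge[OF assms(1) S xzG] by simp
      then show False using largest_tree_few_leaves[OF _ assms(2-4) le] assms(5) by simp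
    qed
    have "leaves ?S \<subseteq> insert ?p (leaves T - {x})" using leaf by fast
    then have "card (leaves ?S) \<le> card (insert ?p (leaves T - {x}))"
      using finL by (intro card_mono) auto
    also have "\<dots> \<le> Suc (card (leaves T - {x}))" by (rule card_insert_le_m1) auto
    finally have LS: "largest_tree (k + 1) G ?S"
      using largest_tree_swap_edge[OF assms(1) S xzG] cLx by simp
    have yp: "y \<noteq> ?p" using deg_p2 y(2) by auto
    \<comment> \<open>The exchange does not touch \<open>y\<close>, so \<open>y\<close> and
      \<open>?p\<close> are leaves of the same largest tree and hence not adjacent in
      \<open>G\<close>.\<close>
    have "y \<in> leaves ?S" "?p \<in> leaves ?S"
      using deg[of y] deg[of ?p] yp y zV yL(2) False pz deg_p2 par(1)[OF zV(1,2)]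
      by (auto simp: leaves_def)
    then have "\<not> adjacent G y ?p" using no_adj[OF LS] yp by blast
    with deg_p2 show ?thesis by (simp add: nbrs_def)
  qed
  \<comment> \<open>Two children with a common parent give it degree at least 2 if it is the root,
    and at least 3 otherwise, where its own parent counts too. The root has degree 1 and the other
    parents have degree 2.\<close>
  have "inj_on par (nbrs G x)"
  proof (rule inj_onI, rule ccontr)
    fix z w assume z: "z \<in> nbrs G x" and w: "w \<in> nbrs G x" and eq: "par z = par w" and ne: "z \<noteq> w"
    let ?p = "par z"
    have zw: "{z, w} \<subseteq> nbrs T ?p"
      using par(2)[of z] par(2)[of w] nx[OF z] nx[OF w] eq by (auto simp: nbrs_def)
    show False
    proof (cases "?p = x")
      case True
      with card_le_degree[OF T(2) zw] ne x(2) show False by simp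
    next
      case False
      have pV: "?p \<in> verts T" using par(1) nx[OF z] by blast
      have "d z = Suc (d ?p)" "d w = Suc (d ?p)" "d ?p = Suc (d (par ?p))"
        using par(3)[OF pV False] par(3)[OF nx(1,2)[OF z]] par(3)[OF nx(1,2)[OF w]] eq by metis+
      then have "d (par ?p) \<noteq> d z" "d (par ?p) \<noteq> d w" by linarith+
      then have "par ?p \<noteq> z" "par ?p \<noteq> w" by metis+
      moreover have "{par ?p, z, w} \<subseteq> nbrs T ?p"
        using zw adjacent_sym[OF par(2)[OF pV False]] by (auto simp: nbrs_def)
      ultimately have "degree T ?p \<ge> 3"
        using card_le_degree[OF T(2), of "{par ?p, z, w}" ?p] ne by simp
      with key[OF z] False show False by simp
    qed
  qed
  then have "card (par ` nbrs G x) = degree G x"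
    by (simp add: card_image degree_eq_card_nbrs[OF assms(3)])
  moreover have "card (nbrs G y) = degree G y"
    by (simp add: degree_eq_card_nbrs[OF assms(3)])
  moreover have "card (par ` nbrs G x \<union> nbrs G y) = card (par ` nbrs G x) + card (nbrs G y)"
    using key finite_nbrs[OF assms(3)] by (intro card_Un_disjoint) auto
  \<comment> \<open>The leaf \<open>x\<close> must stay available, as it is the parent of its own
    neighbour in \<open>T\<close>. All other parents have degree 2, and a neighbour of the leaf
    \<open>y\<close> is never a leaf.\<close>
  moreover have "par ` nbrs G x \<union> nbrs G y \<subseteq> verts T - (leaves T - {x})"
  proof
    fix v assume "v \<in> par ` nbrs G x \<union> nbrs G y"
    then show "v \<in> verts T - (leaves T - {x})"
    proof
      assume "v \<in> par ` nbrs G x"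
      then obtain z where z: "z \<in> nbrs G x" "v = par z" by blast
      with key[OF z(1)] par(1) nx[OF z(1)] show ?thesis by (auto simp: leaves_def)
    next
      assume v: "v \<in> nbrs G y"
      then have "v \<noteq> y" "adjacent G y v"
        using adjacent_in_verts(3)[OF assms(3)] by (auto simp: nbrs_def)
      moreover from this have "v \<notin> leaves T" using no_adj[OF assms(1) yL(1), of v] by auto
      ultimately show ?thesis using v sub[OF yL(1)] by auto
    qed
  qed
  then have "card (par ` nbrs G x \<union> nbrs G y) \<le> card (verts T - (leaves T - {x}))"
    using finV by (intro card_mono) auto
  moreover have "card (verts T - (leaves T - {x})) = card (verts T) - k"
    using cLx finL by (subst card_Diff_subset) (auto simp: leaves_def)
  moreover have "k \<le> card (verts T)"
    using cLx card_mono[OF finV, of "leaves T - {x}"] by (auto simp: leaves_def)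
  ultimately have "degree G x + degree G y + k \<le> card (verts T)" by linarith
  moreover have "x \<in> verts G" "y \<in> verts G" using x y T(4) by (auto simp: subgraph_of_def)
  ultimately show ?thesis using yL(2) nxy by (intro that[of x y]) auto
qed

text \<open>For \<open>m\<close> at least 2 the trees behind \<open>max_ended_order\<close> are
  genuine trees. Their orders are bounded by that of \<open>G\<close>, and a single vertex, which
  has no leaves, shows that the maximum is taken over a nonempty set.\<close>

lemma largest_tree_exists:
  assumes "simple_graph G" "connected_graph G" "m \<ge> 2"
  obtains T where "largest_tree m G T" "card (verts T) = max_ended_order G m"
proof -
  let ?A = "{card (verts T) | T. subgraph_of T G \<and> ended_tree m T}"
  have fin: "finite (verts G)" using assms(1) by (simp add: simple_graph_def)
  have "?A \<subseteq> {..card (verts G)}" using card_mono[OF fin] by (auto simp: subgraph_of_def)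
  then have finA: "finite ?A" by (rule finite_subset) simp
  obtain v where v: "v \<in> verts G" using assms(2) by (auto simp: connected_graph_def)
  let ?T = "\<lparr>verts = {v}, edges = {}\<rparr>"
  have "is_tree ?T" by (rule is_treeI) (auto simp: simple_graph_def connected_graph_def)
  moreover have "leaves ?T = {}" by (auto simp: leaves_def degree_def)
  ultimately have "subgraph_of ?T G \<and> ended_tree m ?T"
    using v assms(3) by (auto simp: subgraph_of_def ended_tree_def is_tree_def)
  then have "?A \<noteq> {}" by blast
  with finA have "Max ?A \<in> ?A" by (rule Max_in)
  then obtain T where T: "subgraph_of T G" "ended_tree m T" "card (verts T) = Max ?A" by auto
  have "card (verts T') \<le> card (verts T)"
    if "subgraph_of T' G" "is_tree T'" "card (leaves T') \<le> m" for T'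
    unfolding T(3) using that assms(3) finA by (intro Max_ge) (auto simp: ended_tree_def)
  with T assms(3) have "largest_tree m G T" by (auto simp: largest_tree_def ended_tree_def)
  with T(3) show ?thesis using that by (simp add: max_ended_order_def)
qed

theorem theorem2:
  fixes G :: "'a ugraph" and k :: nat
  assumes "simple_graph G"
    and "connected_graph G"
    and "k \<ge> 1"
    and "sigma2 G \<ge> ereal (real (max_ended_order G (k + 1)) - real k + 1)"
  shows "\<exists>T. spanning_subgraph T G \<and> ended_tree k T"
proof (rule ccontr)
  assume "\<not> ?thesis"
  then have no: "\<not> has_spanning_ended_tree k G" by (simp add: has_spanning_ended_tree_def)
  obtain T where T: "largest_tree (k + 1) G T" "card (verts T) = max_ended_order G (k + 1)"
    using largest_tree_exists[OF assms(1,2), of "k + 1"] assms(3) by auto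
  obtain x y where xy: "x \<in> verts G" "y \<in> verts G" "x \<noteq> y" "\<not> adjacent G x y"
    "degree G x + degree G y + k \<le> card (verts T)"
    using largest_tree_degree_sum[OF T(1) assms(3,1,2) no] by blast
  \<comment> \<open>The degree sum is at most \<open>card (verts T) - k\<close>, one less than the
    hypothesis demands.\<close>
  have "ereal (real (max_ended_order G (k + 1)) - real k + 1) \<le> ereal (real (degree G x + degree G y))"
    using assms(4) sigma2_le_degree_sum[OF assms(1) xy(1-4)] by (rule order_trans)
  then have "real (max_ended_order G (k + 1)) - real k + 1 \<le> real (degree G x + degree G y)"
    by simp
  with xy(5) T(2) show False by linarith
qed

end
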